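(* Let $m\geq 1$ be an integer, let $\beta\in(0,1)$ be a real number satisfying $\beta^2+m\beta=1$, and let $(G_n)_{n\geq 0}$ be the integer sequence defined by $G_0=0$, $G_1=1$, $G_{n+2}=mG_{n+1}+G_n$ for $n\geq 0$. Let $i\geq 1$ be an integer. For $j\in\mathbb{Z}$ put $$\varepsilon_i(j)=\bigl\lfloor \beta(j+G_i)\bigr\rfloor - \lfloor \beta j\rfloor - G_{i-1}.$$ Define $$U_i=\bigl\{kG_{i+1}+\lfloor k\beta\rfloor G_i \,\bigm|\, k\in\mathbb{Z},\ k\neq 0\bigr\}\ \cup\ \Bigl\{\tfrac{(-1)^i-1}{2}\,G_i\Bigr\}.$$ Then for every $j\in\mathbb{Z}$, $$\varepsilon_i(j)=\begin{cases}0 & \text{if } j\notin U_i,\\ (-1)^{i+1} & \text{if } j\in U_i.\end{cases}$$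
   Context: $\lfloor x\rfloor$ denotes the greatest integer not exceeding the real number $x$. *)

theory Defs
  imports Complex_Main
begin

fun G :: "int \<Rightarrow> nat \<Rightarrow> int" where
  "G m 0 = 0"
| "G m (Suc 0) = 1"
| "G m (Suc (Suc n)) = m * G m (Suc n) + G m n"

text \<open>Truncated subtraction makes \<open>i - 1\<close> meaningful only for \<open>i \<ge> 1\<close>.\<close>

definition eps :: "int \<Rightarrow> real \<Rightarrow> nat \<Rightarrow> int \<Rightarrow> int" where
  "eps m \<beta> i j =
     \<lfloor>\<beta> * real_of_int (j + G m i)\<rfloor> - \<lfloor>\<beta> * real_of_int j\<rfloor> - G m (i - 1)"

text \<open>The integer division by 2 is exact: \<open>(-1) ^ i - 1\<close> is \<open>0\<close> or \<open>-2\<close>.\<close>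

definition U :: "int \<Rightarrow> real \<Rightarrow> nat \<Rightarrow> int set" where
  "U m \<beta> i =
     {k * G m (i + 1) + \<lfloor>real_of_int k * \<beta>\<rfloor> * G m i | k :: int. k \<noteq> 0}
     \<union> {(((-1) ^ i - 1) div 2) * G m i}"

end

theory Submission
  imports Defs
begin

text \<open>
  From \<open>\<beta> G\<^sub>i = G\<^sub>i\<^sub>-\<^sub>1 - (-\<beta>)\<^sup>i\<close>, \<open>\<epsilon>\<^sub>i(j)\<close> is nonzero exactly when the
  fractional part of \<open>\<beta> j\<close> is less than \<open>\<beta>\<^sup>i\<close> (\<open>i\<close> even) or at least \<open>1 - \<beta>\<^sup>i\<close> (\<open>i\<close> odd).
  By Cassini's identity \<open>(k, l) \<mapsto> (k G\<^sub>i\<^sub>+\<^sub>1 + l G\<^sub>i, k G\<^sub>i + l G\<^sub>i\<^sub>-\<^sub>1)\<close> is a bijection of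
  \<open>\<int>\<^sup>2\<close>, and if \<open>(j, N)\<close> is the image of \<open>(k, l)\<close> then \<open>\<beta> j - N = (-\<beta>)\<^sup>i (k \<beta> - l)\<close>.
  So the condition on the fractional part confines \<open>k \<beta> - l\<close> to \<open>[0, 1)\<close>, respectively
  \<open>(0, 1]\<close>, that is \<open>l = \<lfloor>k \<beta>\<rfloor>\<close>, except that for odd \<open>i\<close> the pair \<open>(0, -1)\<close> takes the
  place of \<open>(0, 0)\<close>.
\<close>

text \<open>Since \<open>- \<beta>\<close> is a root of \<open>x\<^sup>2 = m * x + 1\<close>, both
  sides satisfy the recurrence of \<open>G\<close>, and they agree at the first two indices.\<close>

lemma mult_G_Suc:
  fixes \<beta> :: real
  assumes "\<beta>\<^sup>2 + of_int m * \<beta> = 1"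
  shows "\<beta> * of_int (G m (Suc n)) = of_int (G m n) - (- \<beta>) ^ Suc n"
proof (induction n rule: induct_nat_012)
  case 1
  then show ?case using assms by (simp add: power2_eq_square algebra_simps)
next
  case (ge2 n)
  define x where "x = (- \<beta>) ^ Suc n"
  have b: "\<beta> * \<beta> = 1 - of_int m * \<beta>"
    using assms by (simp add: power2_eq_square)
  have x3: "(- \<beta>) ^ Suc (Suc (Suc n)) = x - of_int m * (\<beta> * x)"
  proof -
    have "(- \<beta>) ^ Suc (Suc (Suc n)) = (\<beta> * \<beta>) * x"
      by (simp add: x_def)
    then show ?thesis by (simp add: b algebra_simps)
  qed
  have x2: "(- \<beta>) ^ Suc (Suc n) = - (\<beta> * x)"
    by (simp add: x_def)
  have "\<beta> * of_int (G m (Suc (Suc (Suc n))))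
      = of_int m * (\<beta> * of_int (G m (Suc (Suc n)))) + \<beta> * of_int (G m (Suc n))"
    by (simp only: G.simps of_int_add of_int_mult) (simp add: algebra_simps)
  also have "\<dots> = of_int m * (of_int (G m (Suc n)) + \<beta> * x) + (of_int (G m n) - x)"
    unfolding ge2.IH x2 by (simp only: x_def) simp
  also have "\<dots> = of_int (G m (Suc (Suc n))) - (- \<beta>) ^ Suc (Suc (Suc n))"
    unfolding x3 by (simp add: algebra_simps)
  finally show ?case .
qed simp

lemma cassini_G: "G m (Suc (Suc n)) * G m n - (G m (Suc n))\<^sup>2 = (-1) ^ Suc n"
  by (induction n) (simp_all add: power2_eq_square algebra_simps)

lemma G_pair_representation:
  obtains k l where "j = k * G m (Suc (Suc n)) + l * G m (Suc n)"
    and "N = k * G m (Suc n) + l * G m n"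
proof
  define c :: int where "c = (-1) ^ Suc n"
  have cc: "c * c = 1"
    by (simp add: c_def flip: power_mult_distrib)
  have d: "G m (Suc (Suc n)) * G m n - G m (Suc n) * G m (Suc n) = c"
    using cassini_G[of m n] by (simp only: c_def power2_eq_square)
  \<comment> \<open>Cramer's rule: the determinant \<open>c\<close> is 1 or -1, hence its own
    inverse.\<close>
  define k where "k = c * (G m n * j - G m (Suc n) * N)"
  define l where "l = c * (G m (Suc (Suc n)) * N - G m (Suc n) * j)"
  have "k * G m (Suc (Suc n)) + l * G m (Suc n)
      = c * (G m (Suc (Suc n)) * G m n - G m (Suc n) * G m (Suc n)) * j"
    by (simp only: k_def l_def) algebra
  then show "j = k * G m (Suc (Suc n)) + l * G m (Suc n)"
    by (simp only: d cc mult_1)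
  have "k * G m (Suc n) + l * G m n
      = c * (G m (Suc (Suc n)) * G m n - G m (Suc n) * G m (Suc n)) * N"
    by (simp only: k_def l_def) algebra
  then show "N = k * G m (Suc n) + l * G m n"
    by (simp only: d cc mult_1)
qed

text \<open>Combine \<open>mult_G_Suc\<close> at two consecutive indices with weights
  \<open>k\<close> and \<open>l\<close>; the error terms share the factor
  \<open>(- \<beta>) ^ Suc n\<close>.\<close>

lemma mult_G_pair:
  fixes \<beta> :: real
  assumes "\<beta>\<^sup>2 + of_int m * \<beta> = 1"
  shows "\<beta> * of_int (k * G m (Suc (Suc n)) + l * G m (Suc n))
    = of_int (k * G m (Suc n) + l * G m n) + (- \<beta>) ^ Suc n * (of_int k * \<beta> - of_int l)"
proof -
  have "\<beta> * of_int (k * G m (Suc (Suc n)) + l * G m (Suc n))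
      = of_int k * (\<beta> * of_int (G m (Suc (Suc n)))) + of_int l * (\<beta> * of_int (G m (Suc n)))"
    by (simp only: of_int_add of_int_mult) (simp add: algebra_simps)
  then show ?thesis
    unfolding mult_G_Suc[OF assms] by (simp add: algebra_simps)
qed

text \<open>Descent: if \<open>k \<beta> = p\<close> is an integer then so is \<open>p \<beta> = k - m p\<close>, and \<open>0 < p < k\<close>.\<close>

lemma mult_nat_not_int:
  fixes \<beta> :: real
  assumes "0 < \<beta>" "\<beta> < 1" "\<beta>\<^sup>2 + of_int m * \<beta> = 1" "k > 0"
  shows "of_nat k * \<beta> \<noteq> of_int p"
  using \<open>k > 0\<close>
proof (induction k arbitrary: p rule: less_induct)
  case (less k)
  show ?case
  proof
    assume eq: "of_nat k * \<beta> = of_int p"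
    have "0 < real_of_int p"
      using less.prems assms(1) by (simp flip: eq)
    then have p: "0 < p" by simp
    have "real_of_int p < of_nat k"
      using less.prems assms(2) by (simp flip: eq)
    then have "nat p < k" using p by linarith
    moreover have "of_nat (nat p) * \<beta> = of_int (int k - m * p)"
    proof -
      have "of_int p * \<beta> = of_nat k * \<beta>\<^sup>2"
        by (simp add: power2_eq_square flip: eq)
      also have "\<dots> = of_nat k * (1 - of_int m * \<beta>)"
        by (simp only: eq_diff_eq[THEN iffD2, OF assms(3)])
      also have "\<dots> = of_nat k - of_int m * (of_nat k * \<beta>)"
        by (simp add: algebra_simps)
      finally show ?thesis using p by (simp add: eq)
    qed
    ultimately show False
      using less.IH[of "nat p"] p by (metis zero_less_nat_eq)
  qed
qed

lemma mult_int_eq_int_iff: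
  fixes \<beta> :: real
  assumes "0 < \<beta>" "\<beta> < 1" "\<beta>\<^sup>2 + of_int m * \<beta> = 1"
  shows "of_int k * \<beta> = of_int p \<longleftrightarrow> k = 0 \<and> p = 0"
proof
  assume eq: "of_int k * \<beta> = of_int p"
  \<comment> \<open>Multiplying by \<open>sgn k\<close> reduces to a nonnegative multiple of
    \<beta>.\<close>
  have "of_nat (nat \<bar>k\<bar>) * \<beta> = of_int (sgn k * p)"
    using eq by (cases "0::int" k rule: linorder_cases) auto
  then have "nat \<bar>k\<bar> = 0"
    using mult_nat_not_int[OF assms] by blast
  then show "k = 0 \<and> p = 0" using eq by simp
qed simp

text \<open>The floor is at least \<open>N\<close>; if it is larger, the fractional part only gets
  smaller than \<open>y\<close>.\<close>

lemma frac_of_int_add_less: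
  fixes y :: real
  assumes "0 \<le> y" "y < b"
  shows "frac (of_int N + y) < b"
proof -
  have "N \<le> \<lfloor>of_int N + y\<rfloor>"
    using assms by (simp add: le_floor_iff del: floor_add_int)
  then have "real_of_int N \<le> of_int \<lfloor>of_int N + y\<rfloor>"
    by (simp only: of_int_le_iff)
  then show ?thesis
    using assms unfolding frac_def by linarith
qed

lemma frac_of_int_diff_ge:
  fixes y :: real
  assumes "0 < y" "y \<le> b"
  shows "1 - b \<le> frac (of_int N - y)"
proof -
  have "\<lfloor>of_int N - y\<rfloor> \<le> N - 1"
    using assms by (simp add: floor_less_iff)
  then have "of_int \<lfloor>of_int N - y\<rfloor> \<le> real_of_int (N - 1)"
    by (simp only: of_int_le_iff)
  then show ?thesis
    using assms unfolding frac_def by simp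
qed

lemma mem_U_even_iff:
  fixes \<beta> :: real
  assumes "0 < \<beta>" "\<beta>\<^sup>2 + of_int m * \<beta> = 1" and "even (Suc n)"
  shows "j \<in> U m \<beta> (Suc n) \<longleftrightarrow> frac (\<beta> * of_int j) < \<beta> ^ Suc n"
proof -
  have pos: "0 < \<beta> ^ Suc n" using assms(1) by simp
  have pow: "(- \<beta>) ^ Suc n = \<beta> ^ Suc n" "(-1 :: int) ^ Suc n = 1"
    by (simp_all only: power_minus_even[OF assms(3)] power_one)
  have "j \<in> U m \<beta> (Suc n) \<longleftrightarrow>
      (\<exists>k. k \<noteq> 0 \<and> j = k * G m (Suc (Suc n)) + \<lfloor>of_int k * \<beta>\<rfloor> * G m (Suc n)) \<or> j = 0"
    unfolding U_def pow by auto
  \<comment> \<open>The exceptional element 0 is the value of the general formula at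
    \<open>k = 0\<close>.\<close>
  also have "\<dots> \<longleftrightarrow> (\<exists>k. j = k * G m (Suc (Suc n)) + \<lfloor>of_int k * \<beta>\<rfloor> * G m (Suc n))"
    by (metis add_0 floor_zero mult_zero_left of_int_0)
  finally have U: "j \<in> U m \<beta> (Suc n) \<longleftrightarrow>
      (\<exists>k. j = k * G m (Suc (Suc n)) + \<lfloor>of_int k * \<beta>\<rfloor> * G m (Suc n))" .
  show ?thesis
  proof
    assume "j \<in> U m \<beta> (Suc n)"
    then obtain k where j: "j = k * G m (Suc (Suc n)) + \<lfloor>of_int k * \<beta>\<rfloor> * G m (Suc n)"
      unfolding U by blast
    show "frac (\<beta> * of_int j) < \<beta> ^ Suc n"
    proof -
      have e: "\<beta> * of_int j = of_int (k * G m (Suc n) + \<lfloor>of_int k * \<beta>\<rfloor> * G m n)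
          + \<beta> ^ Suc n * frac (of_int k * \<beta>)"
        unfolding j mult_G_pair[OF assms(2)] pow frac_def ..
      have "0 \<le> \<beta> ^ Suc n * frac (of_int k * \<beta>)"
        using pos by simp
      moreover have "\<beta> ^ Suc n * frac (of_int k * \<beta>) < \<beta> ^ Suc n"
        using pos frac_lt_1[of "of_int k * \<beta>"] by (metis mult.right_neutral mult_strict_left_mono)
      ultimately show ?thesis
        unfolding e by (intro frac_of_int_add_less)
    qed
  next
    assume lt: "frac (\<beta> * of_int j) < \<beta> ^ Suc n"
    \<comment> \<open>With the floor as second coordinate, the error term is exactly the fractional
      part.\<close>
    obtain k l where j: "j = k * G m (Suc (Suc n)) + l * G m (Suc n)"
      and N: "\<lfloor>\<beta> * of_int j\<rfloor> = k * G m (Suc n) + l * G m n"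
      using G_pair_representation .
    have f: "frac (\<beta> * of_int j) = \<beta> ^ Suc n * (of_int k * \<beta> - of_int l)"
      unfolding frac_def N using mult_G_pair[OF assms(2), of k n l] by (simp only: pow j)
    have "0 \<le> of_int k * \<beta> - of_int l"
      using f pos frac_ge_0[of "\<beta> * of_int j"] by (simp only: zero_le_mult_iff) linarith
    moreover have "of_int k * \<beta> - of_int l < 1"
      using lt pos unfolding f by (simp only: mult_less_cancel_left2)
    ultimately have "\<lfloor>of_int k * \<beta>\<rfloor> = l" by linarith
    then show "j \<in> U m \<beta> (Suc n)"
      unfolding U using j by blast
  qed
qed

lemma mem_U_odd_iff:
  fixes \<beta> :: real
  assumes "0 < \<beta>" "\<beta> < 1" "\<beta>\<^sup>2 + of_int m * \<beta> = 1" and "odd (Suc n)"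
  shows "j \<in> U m \<beta> (Suc n) \<longleftrightarrow> 1 - \<beta> ^ Suc n \<le> frac (\<beta> * of_int j)"
proof -
  have pos: "0 < \<beta> ^ Suc n" using assms(1) by simp
  have pow: "(- \<beta>) ^ Suc n = - (\<beta> ^ Suc n)" "(-1 :: int) ^ Suc n = - 1"
    by (simp_all only: power_minus_odd[OF assms(4)] power_one)
  have U: "j \<in> U m \<beta> (Suc n) \<longleftrightarrow>
      (\<exists>k. k \<noteq> 0 \<and> j = k * G m (Suc (Suc n)) + \<lfloor>of_int k * \<beta>\<rfloor> * G m (Suc n)) \<or> j = - G m (Suc n)"
    unfolding U_def pow by auto
  show ?thesis
  proof
    assume "j \<in> U m \<beta> (Suc n)"
    then obtain k l where j: "j = k * G m (Suc (Suc n)) + l * G m (Suc n)"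
      and kl: "k \<noteq> 0 \<and> l = \<lfloor>of_int k * \<beta>\<rfloor> \<or> k = 0 \<and> l = -1"
      unfolding U by (metis add_0 mult_minus1 mult_zero_left)
    define t where "t = of_int k * \<beta> - of_int l"
    have t: "0 < t" "t \<le> 1"
    proof -
      \<comment> \<open>Irrationality of \<beta> rules out \<open>t = 0\<close> when
        \<open>l\<close> is the floor; the pair \<open>(0, -1)\<close> gives
        \<open>t = 1\<close>.\<close>
      have "of_int k * \<beta> \<noteq> of_int l" if "k \<noteq> 0"
        using mult_int_eq_int_iff[OF assms(1-3)] that by blast
      then show "0 < t" "t \<le> 1" using kl unfolding t_def by (auto; linarith)+
    qed
    have e: "\<beta> * of_int j = of_int (k * G m (Suc n) + l * G m n) - \<beta> ^ Suc n * t"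
      unfolding j mult_G_pair[OF assms(3)] pow t_def by simp
    have "0 < \<beta> ^ Suc n * t"
      using t pos by (intro mult_pos_pos)
    moreover have "\<beta> ^ Suc n * t \<le> \<beta> ^ Suc n"
      using t pos by (intro mult_left_le) auto
    ultimately show "1 - \<beta> ^ Suc n \<le> frac (\<beta> * of_int j)"
      unfolding e by (intro frac_of_int_diff_ge)
  next
    assume le: "1 - \<beta> ^ Suc n \<le> frac (\<beta> * of_int j)"
    \<comment> \<open>For odd exponent the error is subtracted, so the integer just above
      \<open>\<beta> * j\<close> replaces the floor.\<close>
    obtain k l where j: "j = k * G m (Suc (Suc n)) + l * G m (Suc n)"
      and N: "\<lfloor>\<beta> * of_int j\<rfloor> + 1 = k * G m (Suc n) + l * G m n"
      using G_pair_representation .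
    define t where "t = of_int k * \<beta> - of_int l"
    have "\<beta> * of_int j = of_int (\<lfloor>\<beta> * of_int j\<rfloor> + 1) - \<beta> ^ Suc n * t"
      unfolding N t_def using mult_G_pair[OF assms(3), of k n l] by (simp add: pow j del: power_Suc)
    then have f: "1 - frac (\<beta> * of_int j) = \<beta> ^ Suc n * t"
      unfolding frac_def by simp
    have "0 < \<beta> ^ Suc n * t"
      using f frac_lt_1[of "\<beta> * of_int j"] by linarith
    then have t0: "0 < t"
      using pos by (simp only: zero_less_mult_iff) linarith
    have "\<beta> ^ Suc n * t \<le> \<beta> ^ Suc n" using f le by linarith
    then have t1: "t \<le> 1"
      using pos by (simp only: mult_le_cancel_left2)
    show "j \<in> U m \<beta> (Suc n)"
    proof (cases "k = 0")
      case True
      then have "l = -1" using t0 t1 unfolding t_def by simp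
      then show ?thesis using j True unfolding U by simp
    next
      case False
      \<comment> \<open>\<open>t = 1\<close> would make \<open>k * \<beta>\<close> the integer
        \<open>l + 1\<close>.\<close>
      then have "t \<noteq> 1"
        using mult_int_eq_int_iff[OF assms(1-3), of k "l + 1"] unfolding t_def by auto
      then have "\<lfloor>of_int k * \<beta>\<rfloor> = l"
        using t0 t1 unfolding t_def by linarith
      then show ?thesis using j False unfolding U by blast
    qed
  qed
qed

theorem theorem2:
  fixes m :: int and \<beta> :: real and i :: nat and j :: int
  assumes "m \<ge> 1"
    and "0 < \<beta>" and "\<beta> < 1"
    and "\<beta>\<^sup>2 + real_of_int m * \<beta> = 1"
    and "i \<ge> 1"
  shows "eps m \<beta> i j = (if j \<notin> U m \<beta> i then 0 else (-1) ^ (i + 1))"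
proof -
  obtain n where i: "i = Suc n" using \<open>i \<ge> 1\<close> by (cases i) auto
  have pos: "0 < \<beta> ^ i" using assms(2) by simp
  have le1: "\<beta> ^ i \<le> 1" using assms(2,3) by (intro power_le_one) auto
  have "\<beta> * of_int (j + G m i) = \<beta> * of_int j - (- \<beta>) ^ i + of_int (G m n)"
    using mult_G_Suc[OF assms(4), of n] by (simp add: i distrib_left del: power_Suc)
  \<comment> \<open>Now \<open>eps\<close> measures whether a shift of length
    \<open>\<beta> ^ i\<close>, at most 1, changes the floor.\<close>
  then have eps: "eps m \<beta> i j = \<lfloor>\<beta> * of_int j - (- \<beta>) ^ i\<rfloor> - \<lfloor>\<beta> * of_int j\<rfloor>"
    unfolding eps_def by (simp add: i del: power_Suc)
  show ?thesis
  proof (cases "even i")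
    case True
    then have "j \<in> U m \<beta> i \<longleftrightarrow> frac (\<beta> * of_int j) < \<beta> ^ i"
      using mem_U_even_iff[OF assms(2,4)] i by simp
    moreover have "(- \<beta>) ^ i = \<beta> ^ i" "(-1 :: int) ^ (i + 1) = -1"
      using True by simp_all
    \<comment> \<open>A downward shift lowers the floor, by exactly 1, iff it exceeds the fractional
      part.\<close>
    ultimately show ?thesis
      using pos le1 unfolding eps frac_def by (simp; linarith)
  next
    case False
    then have "j \<in> U m \<beta> i \<longleftrightarrow> 1 - \<beta> ^ i \<le> frac (\<beta> * of_int j)"
      using mem_U_odd_iff[OF assms(2-4)] i by simp
    moreover have "(- \<beta>) ^ i = - (\<beta> ^ i)" "(-1 :: int) ^ (i + 1) = 1"
      using False by simp_all
    \<comment> \<open>An upward shift raises the floor, by exactly 1, iff it covers the distance to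
      the next integer.\<close>
    ultimately show ?thesis
      using pos le1 unfolding eps frac_def by (simp; linarith)
  qed
qed

end
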